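(* Let $X$ be a countably infinite set and let $I$ be an ideal on $X$. Then $\mathcal C_I$ is precomplete if and only if for each subset $A\subseteq X$ with $A\notin I$ there exist $n\ge 1$ and unary functions $g_1,\dots,g_n:X\to A$ such that $g_1^{-1}[B]\cap\dots\cap g_n^{-1}[B]\in I$ for all $B\in I$.
   Context: Let $\mathcal O^{(n)}$ be the set of all functions $X^n\to X$ ($n\ge 1$) and $\mathcal O=\bigcup_{n\ge1}\mathcal O^{(n)}$. A clone on $X$ is a subset of $\mathcal O$ that contains all projections and is closed under composition. A clone $\mathcal C\neq\mathcal O$ is precomplete if there is no clone strictly between $\mathcal C$ and $\mathcal O$. An ideal on $X$ means here a family $I$ of subsets of $X$ that is closed under subsets and finite unions, contains all finite subsets of $X$, contains at least one infinite set, and does not contain all subsets of $X$. For an ideal $I$, $\mathcal C_I=\bigcup_{n\ge1}\{f\in\mathcal O^{(n)}: f[A^n]\in I\text{ for all }A\in I\}$. *)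

theory Defs
  imports "HOL-Library.FuncSet" "HOL-Library.Countable_Set" "HOL-Library.NList"
begin

text \<open>
  The power \<open>X\<^sup>n\<close> is \<^term>\<open>nlists n X\<close>. A finitary operation is a pair of its arity and its
  function. The arity has to be recorded because \<^term>\<open>undefined\<close> may be an element of \<open>X\<close>: then the
  extensional functions representing the constant operations with that value coincide for
  all arities.
\<close>

type_synonym 'a operation = "nat \<times> ('a list \<Rightarrow> 'a)"

definition operations :: "'a set \<Rightarrow> 'a operation set" where
  "operations X = (SIGMA n:{1..}. nlists n X \<rightarrow>\<^sub>E X)"

definition projection :: "'a set \<Rightarrow> nat \<Rightarrow> nat \<Rightarrow> 'a operation" where
  "projection X n i = (n, \<lambda>xs\<in>nlists n X. xs ! i)"

text \<open>
  For \<open>gs = [g\<^sub>1, \<dots>, g\<^sub>n]\<close>, a list of \<open>m\<close>-ary functions, this is the \<open>m\<close>-ary operation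
  \<open>f(g\<^sub>1, \<dots>, g\<^sub>n)\<close>.
\<close>

definition composition :: "'a set \<Rightarrow> nat \<Rightarrow> ('a list \<Rightarrow> 'a) \<Rightarrow> ('a list \<Rightarrow> 'a) list \<Rightarrow> 'a operation" where
  "composition X m f gs = (m, \<lambda>xs\<in>nlists m X. f (map (\<lambda>g. g xs) gs))"

definition clone_on :: "'a set \<Rightarrow> 'a operation set \<Rightarrow> bool" where
  "clone_on X C \<longleftrightarrow>
     C \<subseteq> operations X \<and>
     (\<forall>n\<ge>1. \<forall>i<n. projection X n i \<in> C) \<and>
     (\<forall>n m f gs. (n, f) \<in> C \<longrightarrow> m \<ge> 1 \<longrightarrow> length gs = n \<longrightarrow> (\<forall>g\<in>set gs. (m, g) \<in> C) \<longrightarrow>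
        composition X m f gs \<in> C)"

definition precomplete_clone_on :: "'a set \<Rightarrow> 'a operation set \<Rightarrow> bool" where
  "precomplete_clone_on X C \<longleftrightarrow>
     clone_on X C \<and> C \<noteq> operations X \<and>
     \<not> (\<exists>D. clone_on X D \<and> C \<subset> D \<and> D \<subset> operations X)"

definition ideal_on :: "'a set \<Rightarrow> 'a set set \<Rightarrow> bool" where
  "ideal_on X I \<longleftrightarrow>
     I \<subseteq> Pow X \<and>
     (\<forall>A\<in>I. \<forall>B. B \<subseteq> A \<longrightarrow> B \<in> I) \<and>
     (\<forall>A\<in>I. \<forall>B\<in>I. A \<union> B \<in> I) \<and>
     (\<forall>A. A \<subseteq> X \<longrightarrow> finite A \<longrightarrow> A \<in> I) \<and>
     (\<exists>A\<in>I. infinite A) \<and>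
     I \<noteq> Pow X"

definition ideal_clone :: "'a set \<Rightarrow> 'a set set \<Rightarrow> 'a operation set" where
  "ideal_clone X I = {(n, f) \<in> operations X. \<forall>A\<in>I. f ` nlists n A \<in> I}"

end

theory Submission imports Defs begin

text \<open>
  The condition says that \<open>X\<close> can be coded by tuples of a fixed length over any \<open>A \<notin> I\<close>, in such a
  way that the elements with a code over a given set of \<open>I\<close> form a set of \<open>I\<close>.

  Sufficiency rests on decoding. An operation outside \<open>\<C>\<^sub>I\<close> maps some power of a set \<open>B \<in> I\<close>
  onto a set \<open>A \<notin> I\<close>. Every operation with range inside \<open>B\<close> lies in \<open>\<C>\<^sub>I\<close>, and
  substituting such operations into the given one yields all operations with values in \<open>A\<close>. As \<open>A\<close> is infinite and \<open>X\<close> is countable,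
  an injection into \<open>A\<close> can be added to \<open>g\<^sub>1, \<dots>, g\<^sub>n\<close> to make the code injective; this only shrinks
  the intersection of preimages. The decoding operation then lies in \<open>\<C>\<^sub>I\<close>, because on tuples over
  a set of \<open>I\<close> it takes values in that intersection and one default value. An arbitrary \<open>f\<close> is
  obtained by decoding the \<open>A\<close>-valued operations \<open>g\<^sub>i \<circ> f\<close>.

  Necessity rests on a larger clone attached to \<open>A\<close>: an operation is required to respect \<open>I\<close> only on
  those tuples over \<open>B \<in> I\<close> at which finitely many \<open>A\<close>-valued guard functions take values in
  \<open>B\<close> too. An operation with values in \<open>A\<close> may serve as its own guard, and when \<open>A \<notin> I\<close> some such
  operation lies outside \<open>\<C>\<^sub>I\<close>. Precompleteness therefore makes the larger clone contain everything,
  in particular a unary function mapping some \<open>B\<^sub>0 \<in> I\<close> onto \<open>X\<close>. Its guards,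
  composed with a section \<open>X \<rightarrow> B\<^sub>0\<close>, are the required \<open>g\<^sub>1, \<dots>, g\<^sub>n\<close>.
\<close>

section \<open>Ideals, operations and clones\<close>

lemma ideal_on_mono: "ideal_on X I \<Longrightarrow> A \<in> I \<Longrightarrow> B \<subseteq> A \<Longrightarrow> B \<in> I"
  unfolding ideal_on_def by blast

lemma ideal_on_Un: "ideal_on X I \<Longrightarrow> A \<in> I \<Longrightarrow> B \<in> I \<Longrightarrow> A \<union> B \<in> I"
  unfolding ideal_on_def by blast

lemma ideal_on_subset: "ideal_on X I \<Longrightarrow> A \<in> I \<Longrightarrow> A \<subseteq> X"
  unfolding ideal_on_def by blast

lemma ideal_on_finite: "ideal_on X I \<Longrightarrow> A \<subseteq> X \<Longrightarrow> finite A \<Longrightarrow> A \<in> I"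
  unfolding ideal_on_def by blast

lemma ideal_on_infinite_member: "ideal_on X I \<Longrightarrow> \<exists>A\<in>I. infinite A"
  unfolding ideal_on_def by blast

lemma ideal_on_carrier_notin: "ideal_on X I \<Longrightarrow> X \<notin> I"
  unfolding ideal_on_def by blast

lemma ideal_on_UN:
  assumes "ideal_on X I" "finite J" "\<And>j. j \<in> J \<Longrightarrow> A j \<in> I"
  shows "(\<Union>j\<in>J. A j) \<in> I"
  using assms(2,3)
proof (induction J rule: finite_induct)
  case empty
  show ?case using ideal_on_finite[OF assms(1), of "{}"] by simp
next
  case (insert j J)
  then show ?case using ideal_on_Un[OF assms(1)] by simp
qed

lemma operationsI:
  "m \<ge> 1 \<Longrightarrow> (\<And>xs. xs \<in> nlists m X \<Longrightarrow> f xs \<in> X) \<Longrightarrow> (m, \<lambda>xs\<in>nlists m X. f xs) \<in> operations X"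
  unfolding operations_def by auto

lemma operations_app: "(m, f) \<in> operations X \<Longrightarrow> xs \<in> nlists m X \<Longrightarrow> f xs \<in> X"
  unfolding operations_def by auto

lemma map_in_nlists:
  assumes "length fs = n" "\<And>f. f \<in> set fs \<Longrightarrow> f xs \<in> A"
  shows "map (\<lambda>f. f xs) fs \<in> nlists n A"
  using assms unfolding nlists_def by auto

lemma clone_on_composition:
  assumes "clone_on X C" "(n, f) \<in> C" "m \<ge> 1" "length gs = n" "\<And>g. g \<in> set gs \<Longrightarrow> (m, g) \<in> C"
  shows "(m, \<lambda>xs\<in>nlists m X. f (map (\<lambda>g. g xs) gs)) \<in> C"
proof -
  have "\<forall>n m f gs. (n, f) \<in> C \<longrightarrow> m \<ge> 1 \<longrightarrow> length gs = n \<longrightarrow> (\<forall>g\<in>set gs. (m, g) \<in> C) \<longrightarrow>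
      composition X m f gs \<in> C"
    using assms(1) unfolding clone_on_def by (elim conjE)
  then show ?thesis using assms(2-) unfolding composition_def by simp
qed

lemma ideal_clone_of_range_in_ideal:
  assumes "ideal_on X I" "B \<in> I" "m \<ge> 1" "\<And>xs. xs \<in> nlists m X \<Longrightarrow> f xs \<in> B"
  shows "(m, \<lambda>xs\<in>nlists m X. f xs) \<in> ideal_clone X I"
proof -
  have "(\<lambda>xs\<in>nlists m X. f xs) ` nlists m A \<in> I" if "A \<in> I" for A
  proof (rule ideal_on_mono[OF assms(1,2)])
    show "(\<lambda>xs\<in>nlists m X. f xs) ` nlists m A \<subseteq> B"
      using nlists_mono[OF ideal_on_subset[OF assms(1) that], of m] assms(4) by auto
  qed
  moreover have "(m, \<lambda>xs\<in>nlists m X. f xs) \<in> operations X"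
    using assms(3,4) ideal_on_subset[OF assms(1,2)] by (blast intro: operationsI)
  ultimately show ?thesis unfolding ideal_clone_def by auto
qed


section \<open>The clone of operations respecting the ideal up to guards\<close>

text \<open>
  The set of guards may depend on the operation but not on \<open>B\<close>, because one tuple of functions
  working for all \<open>B \<in> I\<close> is to be extracted from it. The empty set of guards gives back
  preservation of \<open>I\<close>.
\<close>

definition guarded_ideal_clone :: "'a set \<Rightarrow> 'a set set \<Rightarrow> 'a set \<Rightarrow> 'a operation set" where
  "guarded_ideal_clone X I A = {(m, f) \<in> operations X.
     \<exists>G. finite G \<and> G \<subseteq> (nlists m X \<rightarrow> A) \<and>
       (\<forall>B\<in>I. f ` {xs \<in> nlists m B. \<forall>g\<in>G. g xs \<in> B} \<in> I)}"

lemma ideal_clone_subset_guarded: "ideal_clone X I \<subseteq> guarded_ideal_clone X I A"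
proof -
  have "\<exists>G. finite G \<and> G \<subseteq> (nlists m X \<rightarrow> A) \<and>
      (\<forall>B\<in>I. f ` {xs \<in> nlists m B. \<forall>g\<in>G. g xs \<in> B} \<in> I)"
    if "\<forall>B\<in>I. f ` nlists m B \<in> I" for m and f :: "'a list \<Rightarrow> 'a"
    using that by (intro exI[of _ "{}"]) simp
  then show ?thesis unfolding ideal_clone_def guarded_ideal_clone_def by auto
qed

text \<open>
  No function on the nonempty set \<open>X\<^sup>m\<close> has all its values in \<open>{}\<close>, so over \<open>{}\<close> there are no
  guards. That \<open>\<C>\<^sub>I\<close> is a clone thus becomes a case of the same fact for guarded operations.
\<close>

lemma guarded_ideal_clone_empty:
  assumes "X \<noteq> {}"
  shows "guarded_ideal_clone X I {} = ideal_clone X I"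
proof
  show "guarded_ideal_clone X I {} \<subseteq> ideal_clone X I"
  proof
    fix p assume p: "p \<in> guarded_ideal_clone X I {}"
    obtain m f where pe: "p = (m, f)" by (cases p)
    from p pe obtain G where mf: "(m, f) \<in> operations X" and G: "G \<subseteq> (nlists m X \<rightarrow> {})"
      and I: "\<forall>B\<in>I. f ` {xs \<in> nlists m B. \<forall>g\<in>G. g xs \<in> B} \<in> I"
      unfolding guarded_ideal_clone_def by auto
    obtain x where "x \<in> X" using assms by blast
    then have "replicate m x \<in> nlists m X" unfolding nlists_def by auto
    then have "G = {}" using G by blast
    with I mf pe show "p \<in> ideal_clone X I" unfolding ideal_clone_def by simp
  qed
qed (rule ideal_clone_subset_guarded)

text \<open>
  Guarding an \<open>A\<close>-valued operation by itself confines its values to \<open>B\<close> on the tuples that are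
  tested.
\<close>

lemma guarded_ideal_clone_of_range:
  assumes I: "ideal_on X I" and mf: "(m, f) \<in> operations X" and A: "f ` nlists m X \<subseteq> A"
  shows "(m, f) \<in> guarded_ideal_clone X I A"
proof -
  have "f ` {xs \<in> nlists m B. \<forall>g\<in>{f}. g xs \<in> B} \<in> I" if "B \<in> I" for B
    by (rule ideal_on_mono[OF I that]) blast
  moreover have "{f} \<subseteq> (nlists m X \<rightarrow> A)" using A by auto
  ultimately show ?thesis
    using mf unfolding guarded_ideal_clone_def by (auto intro!: exI[of _ "{f}"])
qed

text \<open>
  Guards can be carried through a composition: the guards of the inner operations confine their
  values to a set of \<open>I\<close>, and the guards of the outer operation are evaluated at these values.
\<close>

lemma clone_on_guarded_ideal_clone:
  assumes I: "ideal_on X I"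
  shows "clone_on X (guarded_ideal_clone X I A)"
  unfolding clone_on_def
proof (intro conjI allI impI)
  show "guarded_ideal_clone X I A \<subseteq> operations X"
    unfolding guarded_ideal_clone_def by auto
next
  fix n i :: nat assume n: "n \<ge> 1" and i: "i < n"
  have "(\<lambda>xs\<in>nlists n X. xs ! i) ` nlists n B \<in> I" if "B \<in> I" for B
  proof (rule ideal_on_mono[OF I that])
    have "(\<lambda>xs\<in>nlists n X. xs ! i) xs \<in> B" if xs: "xs \<in> nlists n B" for xs
      using subsetD[OF nlists_mono[OF ideal_on_subset[OF I \<open>B \<in> I\<close>]] xs] nlistsE_nth_in[OF xs i]
      by simp
    then show "(\<lambda>xs\<in>nlists n X. xs ! i) ` nlists n B \<subseteq> B" by blast
  qed
  moreover have "projection X n i \<in> operations X"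
    unfolding projection_def using n nlistsE_nth_in[OF _ i] by (rule operationsI)
  ultimately have "projection X n i \<in> ideal_clone X I"
    unfolding ideal_clone_def projection_def by simp
  then show "projection X n i \<in> guarded_ideal_clone X I A"
    using ideal_clone_subset_guarded by blast
next
  fix n m f fs
  assume nf: "(n, f) \<in> guarded_ideal_clone X I A" and m: "m \<ge> (1::nat)" and len: "length fs = n"
    and fs: "\<forall>h\<in>set fs. (m, h) \<in> guarded_ideal_clone X I A"
  from nf obtain G where f: "(n, f) \<in> operations X" and finG: "finite G"
    and GA: "G \<subseteq> (nlists n X \<rightarrow> A)"
    and G: "\<And>B. B \<in> I \<Longrightarrow> f ` {ys \<in> nlists n B. \<forall>g\<in>G. g ys \<in> B} \<in> I"
    unfolding guarded_ideal_clone_def by auto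
  from fs have fsop: "\<And>h. h \<in> set fs \<Longrightarrow> (m, h) \<in> operations X"
    unfolding guarded_ideal_clone_def by auto
  from fs have "\<forall>h\<in>set fs. \<exists>H. finite H \<and> H \<subseteq> (nlists m X \<rightarrow> A) \<and>
      (\<forall>B\<in>I. h ` {xs \<in> nlists m B. \<forall>g\<in>H. g xs \<in> B} \<in> I)"
    unfolding guarded_ideal_clone_def by auto
  then obtain H where "\<forall>h\<in>set fs. finite (H h) \<and> H h \<subseteq> (nlists m X \<rightarrow> A) \<and>
      (\<forall>B\<in>I. h ` {xs \<in> nlists m B. \<forall>g\<in>H h. g xs \<in> B} \<in> I)"
    by (rule bchoice[THEN exE])
  then have finH: "\<And>h. h \<in> set fs \<Longrightarrow> finite (H h)"
    and HA: "\<And>h. h \<in> set fs \<Longrightarrow> H h \<subseteq> (nlists m X \<rightarrow> A)"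
    and H: "\<And>h B. h \<in> set fs \<Longrightarrow> B \<in> I \<Longrightarrow> h ` {xs \<in> nlists m B. \<forall>g\<in>H h. g xs \<in> B} \<in> I"
    by simp_all
  define inner where "inner xs = map (\<lambda>h. h xs) fs" for xs
  define c where "c = (\<lambda>xs\<in>nlists m X. f (inner xs))"
  have innerX: "inner xs \<in> nlists n X" if "xs \<in> nlists m X" for xs
    unfolding inner_def using len operations_app[OF fsop that] by (intro map_in_nlists)
  define K where "K = (\<Union>h\<in>set fs. H h) \<union> (\<lambda>g. g \<circ> inner) ` G"
  have "finite K" unfolding K_def using finG finH by auto
  moreover have "K \<subseteq> (nlists m X \<rightarrow> A)"
    unfolding K_def using HA GA innerX by fastforce
  moreover have "c ` {xs \<in> nlists m B. \<forall>g\<in>K. g xs \<in> B} \<in> I" if B: "B \<in> I" for B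
  proof -
    \<comment> \<open>\<open>B\<close> itself is included because the pulled back guards of \<open>f\<close> take values in it.\<close>
    define B' where "B' = B \<union> (\<Union>h\<in>set fs. h ` {xs \<in> nlists m B. \<forall>g\<in>H h. g xs \<in> B})"
    have B': "B' \<in> I"
      unfolding B'_def by (intro ideal_on_Un[OF I B] ideal_on_UN[OF I] H B) auto
    have "c ` {xs \<in> nlists m B. \<forall>g\<in>K. g xs \<in> B} \<subseteq> f ` {ys \<in> nlists n B'. \<forall>g\<in>G. g ys \<in> B'}"
    proof
      fix y assume "y \<in> c ` {xs \<in> nlists m B. \<forall>g\<in>K. g xs \<in> B}"
      then obtain xs where xs: "xs \<in> nlists m B" and K: "\<forall>g\<in>K. g xs \<in> B" and y: "y = c xs"
        by auto
      have "xs \<in> nlists m X" using xs nlists_mono[OF ideal_on_subset[OF I B]] by blast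
      then have "y = f (inner xs)" using y by (simp add: c_def)
      moreover have "inner xs \<in> nlists n B'"
        unfolding inner_def using len
      proof (rule map_in_nlists)
        fix h assume h: "h \<in> set fs"
        then have "\<forall>g\<in>H h. g xs \<in> B" using K by (auto simp: K_def)
        then show "h xs \<in> B'" using h xs by (auto simp: B'_def)
      qed
      moreover have "g (inner xs) \<in> B'" if "g \<in> G" for g
      proof -
        have "g \<circ> inner \<in> K" using that by (simp add: K_def)
        then show ?thesis using K by (auto simp: B'_def)
      qed
      ultimately show "y \<in> f ` {ys \<in> nlists n B'. \<forall>g\<in>G. g ys \<in> B'}" by blast
    qed
    then show ?thesis by (rule ideal_on_mono[OF I G[OF B']])
  qed
  moreover have "(m, c) \<in> operations X"
    unfolding c_def using m operations_app[OF f innerX] by (rule operationsI)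
  ultimately have "(m, c) \<in> guarded_ideal_clone X I A"
    unfolding guarded_ideal_clone_def by auto
  then show "composition X m f fs \<in> guarded_ideal_clone X I A"
    unfolding composition_def c_def inner_def .
qed

lemma clone_on_ideal_clone:
  assumes "ideal_on X I" "X \<noteq> {}"
  shows "clone_on X (ideal_clone X I)"
  using clone_on_guarded_ideal_clone[OF assms(1), of "{}"] guarded_ideal_clone_empty[OF assms(2)]
  by simp

section \<open>Unary operations outside the ideal clone\<close>

text \<open>
  For \<open>B \<in> I\<close> and \<open>A \<notin> I\<close> such an operation does not preserve \<open>I\<close>. It numbers the elements of the
  infinite set \<open>B\<close> and maps them along an enumeration of \<open>A\<close>.
\<close>

lemma ex_unary_operation_onto:
  assumes "countable X" "B \<subseteq> X" "infinite B" "A \<subseteq> X" "A \<noteq> {}"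
  obtains f where "(1, f) \<in> operations X" "f ` nlists 1 X \<subseteq> A" "\<forall>y\<in>A. \<exists>x\<in>B. f [x] = y"
proof -
  have cB: "countable B" and cA: "countable A"
    using assms countable_subset by blast+
  define e where "e x = from_nat_into A (to_nat_on B x)" for x
  define f where "f = (\<lambda>xs\<in>nlists 1 X. e (hd xs))"
  have eA: "e x \<in> A" for x unfolding e_def by (rule from_nat_into[OF assms(5)])
  show ?thesis
  proof
    show "(1, f) \<in> operations X"
      unfolding f_def using eA assms(4) by (intro operationsI) auto
    show "f ` nlists 1 X \<subseteq> A" unfolding f_def using eA by auto
    show "\<forall>y\<in>A. \<exists>x\<in>B. f [x] = y"
    proof
      fix y assume y: "y \<in> A"
      let ?x = "from_nat_into B (to_nat_on A y)"
      have x: "?x \<in> B" using assms(3) by (intro from_nat_into) auto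
      then have "[?x] \<in> nlists 1 X" using assms(2) by (auto intro: nlistsI)
      then have "f [?x] = y"
        using y cA cB assms(3) by (simp add: f_def e_def)
      with x show "\<exists>x\<in>B. f [x] = y" by blast
    qed
  qed
qed

lemma notin_ideal_clone_of_image:
  assumes I: "ideal_on X I" and B: "B \<in> I" and A: "A \<notin> I"
    and onto: "\<forall>y\<in>A. \<exists>x\<in>B. f [x] = y"
  shows "(1, f) \<notin> ideal_clone X I"
proof
  assume "(1, f) \<in> ideal_clone X I"
  then have "f ` nlists 1 B \<in> I" using B unfolding ideal_clone_def by auto
  moreover have "A \<subseteq> f ` nlists 1 B"
  proof
    fix y assume "y \<in> A"
    then obtain x where "x \<in> B" "f [x] = y" using onto by blast
    then show "y \<in> f ` nlists 1 B" by (intro image_eqI[of _ _ "[x]"]) (auto intro: nlistsI)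
  qed
  ultimately show False using A ideal_on_mono[OF I] by blast
qed


section \<open>Precompleteness yields codings\<close>

definition ideal_coding :: "'a set \<Rightarrow> 'a set set \<Rightarrow> 'a set \<Rightarrow> nat set \<Rightarrow> (nat \<Rightarrow> 'a \<Rightarrow> 'a) \<Rightarrow> bool" where
  "ideal_coding X I A J g \<longleftrightarrow>
     (\<forall>i\<in>J. g i \<in> X \<rightarrow> A) \<and> (\<forall>B\<in>I. (\<Inter>i\<in>J. {x \<in> X. g i x \<in> B}) \<in> I)"

text \<open>
  Once the guarded clone over \<open>A\<close> contains a function \<open>f\<close> from \<open>B\<^sub>0 \<in> I\<close> onto \<open>X\<close>, pulling its
  guards back along a section \<open>s\<close> of \<open>f\<close> codes \<open>X\<close> over \<open>A\<close>: every \<open>y\<close> is \<open>f (s y)\<close>, hence the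
  elements with a code over \<open>B\<close> are images of tuples at which the guards hold.
\<close>

lemma ideal_coding_if_precomplete:
  assumes X: "countable X" and I: "ideal_on X I"
    and prec: "precomplete_clone_on X (ideal_clone X I)"
    and A: "A \<subseteq> X" "A \<notin> I"
  shows "\<exists>n\<ge>1. \<exists>g. ideal_coding X I A {1..n} g"
proof -
  obtain B0 where B0: "B0 \<in> I" "infinite B0" using ideal_on_infinite_member[OF I] by blast
  note B0X = ideal_on_subset[OF I B0(1)]
  have Ane: "A \<noteq> {}" using A(2) ideal_on_finite[OF I, of "{}"] by auto
  have Xne: "X \<noteq> {}" using A(1) Ane by blast
  obtain h where h: "(1, h) \<in> operations X" "h ` nlists 1 X \<subseteq> A"
    and onto: "\<forall>y\<in>A. \<exists>x\<in>B0. h [x] = y"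
    by (rule ex_unary_operation_onto[OF X B0X B0(2) A(1) Ane])
  let ?D = "guarded_ideal_clone X I A"
  have "(1, h) \<in> ?D" by (rule guarded_ideal_clone_of_range[OF I h])
  moreover have "(1, h) \<notin> ideal_clone X I"
    by (rule notin_ideal_clone_of_image[OF I B0(1) A(2) onto])
  ultimately have "ideal_clone X I \<subset> ?D" using ideal_clone_subset_guarded by blast
  moreover have "clone_on X ?D" by (rule clone_on_guarded_ideal_clone[OF I])
  ultimately have D_eq: "?D = operations X"
    using prec unfolding precomplete_clone_on_def clone_on_def by blast
  obtain f where f: "(1, f) \<in> operations X" "f ` nlists 1 X \<subseteq> X"
    and f_onto: "\<forall>y\<in>X. \<exists>x\<in>B0. f [x] = y"
    by (rule ex_unary_operation_onto[OF X B0X B0(2) subset_refl Xne])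
  have "\<forall>y\<in>X. \<exists>x. x \<in> B0 \<and> f [x] = y" using f_onto by blast
  then obtain s where "\<forall>y\<in>X. s y \<in> B0 \<and> f [s y] = y" by (rule bchoice[THEN exE])
  then have s: "\<And>y. y \<in> X \<Longrightarrow> s y \<in> B0" and fs: "\<And>y. y \<in> X \<Longrightarrow> f [s y] = y"
    by simp_all
  have "(1, f) \<in> ?D" using D_eq f(1) by simp
  then obtain G where finG: "finite G" and GA: "G \<subseteq> (nlists 1 X \<rightarrow> A)"
    and G: "\<And>B. B \<in> I \<Longrightarrow> f ` {xs \<in> nlists 1 B. \<forall>g\<in>G. g xs \<in> B} \<in> I"
    unfolding guarded_ideal_clone_def by auto
  \<comment> \<open>The extra guard \<open>h\<close> makes the family nonempty.\<close>
  define G' where "G' = insert h G"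
  have finG': "finite G'" and GA': "G' \<subseteq> (nlists 1 X \<rightarrow> A)"
    using finG GA h(2) by (auto simp: G'_def)
  obtain e where e: "bij_betw e {1..card G'} G'"
    using ex_bij_betw_nat_finite_1[OF finG'] by blast
  then have eG': "e ` {1..card G'} = G'" by (rule bij_betw_imp_surj_on)
  have "card G' \<ge> 1" using finG' by (simp add: G'_def card_gt_0_iff Suc_le_eq)
  moreover have "ideal_coding X I A {1..card G'} (\<lambda>i y. e i [s y])"
    unfolding ideal_coding_def
  proof (intro conjI ballI)
    fix i assume "i \<in> {1..card G'}"
    then have "e i \<in> nlists 1 X \<rightarrow> A" using eG' GA' by blast
    moreover have "[s y] \<in> nlists 1 X" if "y \<in> X" for y
      using s[OF that] B0X by (auto intro: nlistsI)
    ultimately show "(\<lambda>y. e i [s y]) \<in> X \<rightarrow> A" by blast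
  next
    fix B assume B: "B \<in> I"
    \<comment> \<open>As \<open>s\<close> takes its values in \<open>B\<^sub>0\<close>, the guards have to be tested on the union \<open>B \<union> B\<^sub>0\<close>.\<close>
    show "(\<Inter>i\<in>{1..card G'}. {y \<in> X. e i [s y] \<in> B}) \<in> I"
    proof (rule ideal_on_mono[OF I G[OF ideal_on_Un[OF I B B0(1)]]], rule subsetI)
      fix y assume y: "y \<in> (\<Inter>i\<in>{1..card G'}. {y \<in> X. e i [s y] \<in> B})"
      then have yX: "y \<in> X" using \<open>card G' \<ge> 1\<close> by fastforce
      have "\<forall>g\<in>e ` {1..card G'}. g [s y] \<in> B" using y by blast
      then have "\<forall>g\<in>G. g [s y] \<in> B" unfolding eG' by (simp add: G'_def)
      then have "[s y] \<in> {xs \<in> nlists 1 (B \<union> B0). \<forall>g\<in>G. g xs \<in> B \<union> B0}"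
        using s[OF yX] by (auto intro: nlistsI)
      then show "y \<in> f ` {xs \<in> nlists 1 (B \<union> B0). \<forall>g\<in>G. g xs \<in> B \<union> B0}"
        by (rule image_eqI[where f = f, OF fs[OF yX, symmetric]])
    qed
  qed
  ultimately show ?thesis by blast
qed

section \<open>Codings yield precompleteness\<close>

text \<open>
  A code consisting of a single injection into \<open>A\<close> identifies the elements of \<open>X\<close>; it is put at the
  position \<open>0\<close>, in front of the given functions.
\<close>

lemma ex_injective_ideal_coding:
  assumes X: "countable X" and I: "ideal_on X I"
    and A: "A \<subseteq> X" "A \<notin> I" and g: "ideal_coding X I A {1..n} g" and n: "n \<ge> 1"
  obtains g' where "ideal_coding X I A {..n} g'" "inj_on (g' 0) X"
proof -
  have infA: "infinite A" using ideal_on_finite[OF I A(1)] A(2) by blast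
  have cA: "countable A" using A(1) X countable_subset by blast
  define e where "e x = from_nat_into A (to_nat_on X x)" for x
  have eA: "e x \<in> A" for x
    unfolding e_def using infA by (intro from_nat_into) auto
  have e_inj: "inj_on e X"
    by (rule inj_onI) (simp add: e_def from_nat_into_inj_infinite[OF cA infA] X)
  define g' where "g' i = (if i = 0 then e else g i)" for i
  have "g' i \<in> X \<rightarrow> A" if "i \<le> n" for i
    using that g eA by (auto simp: g'_def ideal_coding_def Pi_iff)
  moreover have "(\<Inter>i\<in>{..n}. {x \<in> X. g' i x \<in> B}) \<in> I" if "B \<in> I" for B
  proof (rule ideal_on_mono[OF I])
    show "(\<Inter>i\<in>{1..n}. {x \<in> X. g i x \<in> B}) \<in> I"
      using g that by (simp add: ideal_coding_def)
    show "(\<Inter>i\<in>{..n}. {x \<in> X. g' i x \<in> B}) \<subseteq> (\<Inter>i\<in>{1..n}. {x \<in> X. g i x \<in> B})"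
    proof (rule INT_greatest)
      fix i assume i: "i \<in> {1..n}"
      then have "(\<Inter>i\<in>{..n}. {x \<in> X. g' i x \<in> B}) \<subseteq> {x \<in> X. g' i x \<in> B}"
        by (intro INT_lower) simp
      also have "g' i = g i" using i by (simp add: g'_def)
      finally show "(\<Inter>i\<in>{..n}. {x \<in> X. g' i x \<in> B}) \<subseteq> {x \<in> X. g i x \<in> B}" .
    qed
  qed
  ultimately have "ideal_coding X I A {..n} g'" by (auto simp: ideal_coding_def)
  moreover have "inj_on (g' 0) X" using e_inj by (simp add: g'_def)
  ultimately show ?thesis by (rule that)
qed

text \<open>
  The inverse of an injective code, extended by one default value to all tuples, preserves \<open>I\<close>:
  the coding condition says exactly that the codes over \<open>B \<in> I\<close> decode to a set of \<open>I\<close>.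
\<close>

lemma ex_decoding_in_ideal_clone:
  assumes I: "ideal_on X I" and ne: "X \<noteq> {}" and A: "A \<subseteq> X"
    and g: "ideal_coding X I A {..n} g" and inj: "inj_on (g 0) X"
  obtains F where "(Suc n, F) \<in> ideal_clone X I"
    "\<And>x. x \<in> X \<Longrightarrow> F (map (\<lambda>i. g i x) [0..<Suc n]) = x"
proof -
  define code where "code x = map (\<lambda>i. g i x) [0..<Suc n]" for x
  obtain c where c: "c \<in> X" using ne by blast
  define F where "F = (\<lambda>ys\<in>nlists (Suc n) X. if ys \<in> code ` X then inv_into X code ys else c)"
  have nth: "code x ! i = g i x" if "i \<le> n" for x i
    unfolding code_def using that by (simp del: upt_Suc)
  have inj_code: "inj_on code X"
    using inj nth[of 0] unfolding inj_on_def by (metis le0)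
  have codeX: "code x \<in> nlists (Suc n) X" if "x \<in> X" for x
  proof (rule nlistsI)
    show "set (code x) \<subseteq> X"
      using that g A by (fastforce simp: ideal_coding_def code_def simp del: upt_Suc)
  qed (simp add: code_def)
  have Fcode: "F (code x) = x" if "x \<in> X" for x
    using that codeX inj_code by (simp add: F_def)
  have "F ` nlists (Suc n) B \<in> I" if B: "B \<in> I" for B
  proof (rule ideal_on_mono[OF I])
    show "(\<Inter>i\<in>{..n}. {x \<in> X. g i x \<in> B}) \<union> {c} \<in> I"
    proof (rule ideal_on_Un[OF I])
      show "(\<Inter>i\<in>{..n}. {x \<in> X. g i x \<in> B}) \<in> I"
        using g B by (simp add: ideal_coding_def)
      show "{c} \<in> I" using c by (intro ideal_on_finite[OF I]) auto
    qed
    show "F ` nlists (Suc n) B \<subseteq> (\<Inter>i\<in>{..n}. {x \<in> X. g i x \<in> B}) \<union> {c}"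
    proof (rule image_subsetI)
      fix ys assume ys: "ys \<in> nlists (Suc n) B"
      then have ysX: "ys \<in> nlists (Suc n) X" using nlists_mono[OF ideal_on_subset[OF I B]] by blast
      show "F ys \<in> (\<Inter>i\<in>{..n}. {x \<in> X. g i x \<in> B}) \<union> {c}"
      proof (cases "ys \<in> code ` X")
        case True
        then obtain x where x: "x \<in> X" "ys = code x" by blast
        have "g i x \<in> B" if "i \<le> n" for i
          using nlistsE_nth_in[OF ys, of i] nth[OF that, of x] that x(2) by simp
        then show ?thesis using x Fcode by simp
      qed (simp add: F_def ysX)
    qed
  qed
  moreover have "(Suc n, F) \<in> operations X"
    unfolding F_def using c by (intro operationsI) (auto simp: inv_into_into)
  ultimately have "(Suc n, F) \<in> ideal_clone X I" unfolding ideal_clone_def by simp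
  with Fcode show ?thesis unfolding code_def by (rule that[rotated])
qed

text \<open>
  Choosing preimages under \<open>h\<close> writes \<open>f\<close> as \<open>h\<close> composed with \<open>B\<close>-valued operations, and these
  all preserve \<open>I\<close> because \<open>B \<in> I\<close>.
\<close>

lemma clone_above_ideal_clone_contains_range:
  assumes I: "ideal_on X I" and D: "clone_on X D" "ideal_clone X I \<subseteq> D"
    and h: "(k, h) \<in> D" and B: "B \<in> I" and m: "m \<ge> 1"
    and range: "\<And>xs. xs \<in> nlists m X \<Longrightarrow> f xs \<in> h ` nlists k B"
  shows "(m, \<lambda>xs\<in>nlists m X. f xs) \<in> D"
proof -
  define u where "u xs = inv_into (nlists k B) h (f xs)" for xs
  have u: "u xs \<in> nlists k B" if "xs \<in> nlists m X" for xs
    unfolding u_def using range[OF that] by (rule inv_into_into)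
  have hu: "h (u xs) = f xs" if "xs \<in> nlists m X" for xs
    unfolding u_def using range[OF that] by (rule f_inv_into_f)
  define us where "us = map (\<lambda>j. \<lambda>xs\<in>nlists m X. u xs ! j) [0..<k]"
  have "(m, v) \<in> D" if v: "v \<in> set us" for v
  proof -
    obtain j where j: "j < k" "v = (\<lambda>xs\<in>nlists m X. u xs ! j)" using v by (auto simp: us_def)
    have "u xs ! j \<in> B" if "xs \<in> nlists m X" for xs
      using nlistsE_nth_in[OF u[OF that] j(1)] .
    then have "(m, v) \<in> ideal_clone X I"
      unfolding j(2) by (rule ideal_clone_of_range_in_ideal[OF I B m])
    then show ?thesis using D(2) by blast
  qed
  moreover have "length us = k" by (simp add: us_def)
  ultimately have "(m, \<lambda>xs\<in>nlists m X. h (map (\<lambda>v. v xs) us)) \<in> D"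
    using clone_on_composition[OF D(1) h m] by blast
  moreover have "h (map (\<lambda>v. v xs) us) = f xs" if xs: "xs \<in> nlists m X" for xs
  proof -
    have "map (\<lambda>v. v xs) us = u xs"
      using nlistsE_length[OF u[OF xs]] xs by (intro nth_equalityI) (simp_all add: us_def)
    then show ?thesis using hu[OF xs] by simp
  qed
  ultimately show ?thesis by (simp cong: restrict_cong)
qed

lemma precomplete_if_ideal_coding:
  assumes X: "countable X" "infinite X" and I: "ideal_on X I"
    and coding: "\<And>A. A \<subseteq> X \<Longrightarrow> A \<notin> I \<Longrightarrow> \<exists>n\<ge>1. \<exists>g. ideal_coding X I A {1..n} g"
  shows "precomplete_clone_on X (ideal_clone X I)"
  unfolding precomplete_clone_on_def
proof (intro conjI notI)
  have Xne: "X \<noteq> {}" using X(2) by auto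
  show "clone_on X (ideal_clone X I)" by (rule clone_on_ideal_clone[OF I Xne])
  show False if eq: "ideal_clone X I = operations X"
  proof -
    obtain B0 where B0: "B0 \<in> I" "infinite B0" using ideal_on_infinite_member[OF I] by blast
    obtain f where "(1, f) \<in> operations X" "f ` nlists 1 X \<subseteq> X"
      "\<forall>y\<in>X. \<exists>x\<in>B0. f [x] = y"
      by (rule ex_unary_operation_onto[OF X(1) ideal_on_subset[OF I B0(1)] B0(2) subset_refl Xne])
    then show False
      using notin_ideal_clone_of_image[OF I B0(1) ideal_on_carrier_notin[OF I]] eq by blast
  qed
  assume "\<exists>D. clone_on X D \<and> ideal_clone X I \<subset> D \<and> D \<subset> operations X"
  then obtain D where D: "clone_on X D" and CD: "ideal_clone X I \<subset> D" and DO: "D \<subset> operations X"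
    by blast
  obtain k h where h: "(k, h) \<in> D" "(k, h) \<notin> ideal_clone X I" using CD by auto
  then have hop: "(k, h) \<in> operations X" using DO by blast
  then obtain B where B: "B \<in> I" and hB: "h ` nlists k B \<notin> I"
    using h(2) unfolding ideal_clone_def by auto
  define A where "A = h ` nlists k B"
  have AX: "A \<subseteq> X"
    using operations_app[OF hop] nlists_mono[OF ideal_on_subset[OF I B]] by (auto simp: A_def)
  have AI: "A \<notin> I" using hB by (simp add: A_def)
  obtain n g0 where "n \<ge> 1" "ideal_coding X I A {1..n} g0" using coding[OF AX AI] by blast
  then obtain g where g: "ideal_coding X I A {..n} g" "inj_on (g 0) X"
    using ex_injective_ideal_coding[OF X(1) I AX AI] by blast
  obtain F where F: "(Suc n, F) \<in> ideal_clone X I"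
    and Fg: "\<And>x. x \<in> X \<Longrightarrow> F (map (\<lambda>i. g i x) [0..<Suc n]) = x"
    using ex_decoding_in_ideal_clone[OF I Xne AX g] by blast
  have "(m, f) \<in> D" if mf: "(m, f) \<in> operations X" for m f
  proof -
    have m: "m \<ge> 1" and fext: "f \<in> nlists m X \<rightarrow>\<^sub>E X" using mf by (auto simp: operations_def)
    define fs where "fs = map (\<lambda>i. \<lambda>xs\<in>nlists m X. g i (f xs)) [0..<Suc n]"
    have "(m, v) \<in> D" if v: "v \<in> set fs" for v
    proof -
      obtain i where "i < Suc n" and i: "v = (\<lambda>xs\<in>nlists m X. g i (f xs))"
        using v unfolding fs_def set_map set_upt by fastforce
      then have "i \<in> {..n}" by simp
      have "g i (f xs) \<in> h ` nlists k B" if "xs \<in> nlists m X" for xs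
        using g(1) \<open>i \<in> {..n}\<close> operations_app[OF mf that] unfolding ideal_coding_def A_def by blast
      then show ?thesis
        unfolding i
        by (rule clone_above_ideal_clone_contains_range[OF I D psubset_imp_subset[OF CD] h(1) B m])
    qed
    moreover have "length fs = Suc n" by (simp add: fs_def)
    ultimately have "(m, \<lambda>xs\<in>nlists m X. F (map (\<lambda>v. v xs) fs)) \<in> D"
      using clone_on_composition[OF D subsetD[OF psubset_imp_subset[OF CD] F] m] by blast
    moreover have "F (map (\<lambda>v. v xs) fs) = f xs" if xs: "xs \<in> nlists m X" for xs
    proof -
      have "map (\<lambda>v. v xs) fs = map (\<lambda>i. g i (f xs)) [0..<Suc n]"
        using xs by (simp add: fs_def del: upt_Suc)
      then show ?thesis using Fg[OF operations_app[OF mf xs]] by simp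
    qed
    moreover have "(\<lambda>xs\<in>nlists m X. f xs) = f"
      using fext by (simp add: PiE_restrict)
    ultimately show ?thesis by (simp cong: restrict_cong)
  qed
  then show False using DO by auto
qed

theorem proposition24:
  fixes X :: "'a set" and I :: "'a set set"
  assumes "countable X" and "infinite X" and "ideal_on X I"
  shows "precomplete_clone_on X (ideal_clone X I) \<longleftrightarrow>
    (\<forall>A. A \<subseteq> X \<longrightarrow> A \<notin> I \<longrightarrow>
      (\<exists>n\<ge>1. \<exists>g :: nat \<Rightarrow> 'a \<Rightarrow> 'a.
        (\<forall>i\<in>{1..n}. g i \<in> X \<rightarrow> A) \<and>
        (\<forall>B\<in>I. (\<Inter>i\<in>{1..n}. {x \<in> X. g i x \<in> B}) \<in> I)))"
  unfolding ideal_coding_def[symmetric]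
proof (intro iffI allI impI)
  fix A assume "precomplete_clone_on X (ideal_clone X I)" "A \<subseteq> X" "A \<notin> I"
  then show "\<exists>n\<ge>1. \<exists>g. ideal_coding X I A {1..n} g"
    by (rule ideal_coding_if_precomplete[OF assms(1,3)])
next
  assume coding: "\<forall>A. A \<subseteq> X \<longrightarrow> A \<notin> I \<longrightarrow> (\<exists>n\<ge>1. \<exists>g. ideal_coding X I A {1..n} g)"
  show "precomplete_clone_on X (ideal_clone X I)"
    by (rule precomplete_if_ideal_coding[OF assms]) (rule coding[rule_format])
qed

end
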